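(* Let $\mathcal{H}$ be an infinite-dimensional separable complex Hilbert space. Every hyponormal tridiagonal bounded linear operator $T$ on $\mathcal{H}$ that is not a scalar multiple of the identity has a nontrivial closed hyperinvariant subspace.
   Context: A bounded operator $T$ is hyponormal if $[T^*,T]=T^*T-TT^*$ is positive semi-definite. $T$ is tridiagonal if there is an (ordered) orthonormal basis $\{e_n\}_{n\in\mathbb{N}}$ of $\mathcal{H}$ such that $\langle T e_n,e_m\rangle=0$ whenever $|m-n|\geq 2$. A closed subspace $M$ is hyperinvariant for $T$ if it is invariant under every bounded operator commuting with $T$; it is nontrivial if $M\neq\{0\}$ and $M\neq\mathcal{H}$. *)

theory Defs
  imports "HOL-Analysis.Analysis"
begin

(* The inner product is linear in its first argument. The norm, metric and topology (and
   completeness) are those of the underlying real Banach space; norm_eq_sqrt_cinner and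
   scaleR_scaleC tie them to the complex structure. *)
class complex_hilbert = banach +
  fixes scaleC :: "complex \<Rightarrow> 'a \<Rightarrow> 'a"  (infixr \<open>*\<^sub>C\<close> 75)
    and cinner :: "'a \<Rightarrow> 'a \<Rightarrow> complex"
  assumes scaleC_add_right: "a *\<^sub>C (x + y) = a *\<^sub>C x + a *\<^sub>C y"
    and scaleC_add_left: "(a + b) *\<^sub>C x = a *\<^sub>C x + b *\<^sub>C x"
    and scaleC_scaleC: "a *\<^sub>C b *\<^sub>C x = (a * b) *\<^sub>C x"
    and scaleC_one: "1 *\<^sub>C x = x"
    and scaleR_scaleC: "scaleR r x = complex_of_real r *\<^sub>C x"
    and cinner_commute: "cinner x y = cnj (cinner y x)"
    and cinner_add_left: "cinner (x + y) z = cinner x z + cinner y z"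
    and cinner_scaleC_left: "cinner (a *\<^sub>C x) y = a * cinner x y"
    and cinner_self_nonneg: "cinner x x \<in> \<real>\<^sub>\<ge>\<^sub>0"
    and cinner_self_eq_0: "cinner x x = 0 \<longleftrightarrow> x = 0"
    and norm_eq_sqrt_cinner: "norm x = sqrt (Re (cinner x x))"

global_interpretation complex_vector:
  vector_space "scaleC :: complex \<Rightarrow> 'a \<Rightarrow> 'a::complex_hilbert"
  by unfold_locales
    (use scaleC_add_right scaleC_add_left scaleC_scaleC scaleC_one in auto)

definition infinite_dimensional :: "'a::complex_hilbert itself \<Rightarrow> bool" where
  "infinite_dimensional TYPE('a) \<longleftrightarrow>
     \<not> (\<exists>B::'a set. finite B \<and> complex_vector.span B = UNIV)"

definition bounded_operator :: "('a::complex_hilbert \<Rightarrow> 'a) \<Rightarrow> bool" where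
  "bounded_operator T \<longleftrightarrow> bounded_linear T \<and> (\<forall>c x. T (c *\<^sub>C x) = c *\<^sub>C T x)"

(* Existence and uniqueness for bounded T are the usual consequence of the Riesz
   representation theorem; for unbounded T the value is unspecified. *)
definition hilbert_adjoint :: "('a::complex_hilbert \<Rightarrow> 'a) \<Rightarrow> 'a \<Rightarrow> 'a" where
  "hilbert_adjoint T =
     (THE S. bounded_operator S \<and> (\<forall>x y. cinner (T x) y = cinner x (S y)))"

definition positive_semidefinite :: "('a::complex_hilbert \<Rightarrow> 'a) \<Rightarrow> bool" where
  "positive_semidefinite A \<longleftrightarrow> (\<forall>x. cinner (A x) x \<in> \<real>\<^sub>\<ge>\<^sub>0)"

definition hyponormal :: "('a::complex_hilbert \<Rightarrow> 'a) \<Rightarrow> bool" where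
  "hyponormal T \<longleftrightarrow>
     positive_semidefinite (\<lambda>x. hilbert_adjoint T (T x) - T (hilbert_adjoint T x))"

definition orthonormal_basis :: "(nat \<Rightarrow> 'a::complex_hilbert) \<Rightarrow> bool" where
  "orthonormal_basis e \<longleftrightarrow>
     (\<forall>m n. cinner (e m) (e n) = (if m = n then 1 else 0)) \<and>
     closure (complex_vector.span (range e)) = UNIV"

definition tridiagonal :: "('a::complex_hilbert \<Rightarrow> 'a) \<Rightarrow> bool" where
  "tridiagonal T \<longleftrightarrow>
     (\<exists>e. orthonormal_basis e \<and>
        (\<forall>m n. \<bar>int m - int n\<bar> \<ge> 2 \<longrightarrow> cinner (T (e n)) (e m) = 0))"

definition hyperinvariant :: "('a::complex_hilbert \<Rightarrow> 'a) \<Rightarrow> 'a set \<Rightarrow> bool" where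
  "hyperinvariant T M \<longleftrightarrow>
     complex_vector.subspace M \<and> closed M \<and>
     (\<forall>S. bounded_operator S \<and> S \<circ> T = T \<circ> S \<longrightarrow> S ` M \<subseteq> M)"

end

theory Submission
  imports Defs "HOL-Computational_Algebra.Fundamental_Theorem_Algebra"
begin

text \<open>
  Write \<open>T e\<^sub>n = c\<^sub>n\<^sub>-\<^sub>1 e\<^sub>n\<^sub>-\<^sub>1 + a\<^sub>n e\<^sub>n + b\<^sub>n e\<^sub>n\<^sub>+\<^sub>1\<close>. The trace of the compression of the
  self-commutator \<open>D\<close> to the span of \<open>e\<^sub>0, \<dots>, e\<^sub>n\<close> telescopes to \<open>t\<^sub>n = \<bar>b\<^sub>n\<bar>\<^sup>2 - \<bar>c\<^sub>n\<bar>\<^sup>2\<close>, so \<open>t\<close> is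
  nonnegative, increasing and bounded, and since \<open>D\<close> is positive its off-diagonal entries
  are summable.

  If some \<open>b\<^sub>n\<close> vanishes, then so does \<open>c\<^sub>n\<close>, the span of \<open>e\<^sub>0, \<dots>, e\<^sub>n\<close> is reducing, and the adjoint
  of \<open>T\<close> has an eigenvector in it. If no \<open>b\<^sub>n\<close> vanishes but some \<open>t\<^sub>n\<close> is positive, summability of the
  entries of \<open>D\<close> forces the \<open>a\<^sub>n\<close> to converge to some \<open>\<alpha>\<close>, and the moduli of \<open>b\<^sub>n\<close> and \<open>c\<^sub>n\<close> to
  converge with \<open>lim \<bar>c\<^sub>n\<bar> < lim \<bar>b\<^sub>n\<bar>\<close>; hence the solution of the three-term recurrence at \<open>\<alpha>\<close> decays
  exponentially and is again an eigenvector of the adjoint. An eigenvector of the adjoint keeps the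
  range of some \<open>T - \<mu>\<close> from being dense. Finally, if all \<open>t\<^sub>n\<close> vanish and no \<open>b\<^sub>n\<close> does, then \<open>D = 0\<close>
  and \<open>T\<close> is an affine function of a self-adjoint operator \<open>A\<close> with \<open>\<langle>A e\<^sub>0, e\<^sub>0\<rangle> = 0 \<noteq> A e\<^sub>0\<close>; the
  kernel of \<open>\<bar>A\<bar> - A\<close> is then nontrivial and hyperinvariant.
\<close>

section \<open>Inner product calculus and bounded operators\<close>

lemma cinner_add_right: "cinner x (y + z) = cinner x y + cinner x (z::'a::complex_hilbert)"
  by (metis cinner_add_left cinner_commute complex_cnj_add)

lemma cinner_scaleC_right: "cinner x (a *\<^sub>C y) = cnj a * cinner x (y::'a::complex_hilbert)"
  by (metis cinner_commute cinner_scaleC_left complex_cnj_mult)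

lemma cinner_zero_left: "cinner 0 (y::'a::complex_hilbert) = 0"
  using cinner_add_left[of 0 0 y] by simp

lemma cinner_zero_right: "cinner (y::'a::complex_hilbert) 0 = 0"
  using cinner_add_right[of y 0 0] by simp

lemma cinner_minus_left: "cinner (- x) (y::'a::complex_hilbert) = - cinner x y"
  using cinner_add_left[of x "- x" y] by (simp add: cinner_zero_left eq_neg_iff_add_eq_0 add.commute)

lemma cinner_minus_right: "cinner x (- y::'a::complex_hilbert) = - cinner x y"
  using cinner_add_right[of x y "- y"] by (simp add: cinner_zero_right eq_neg_iff_add_eq_0 add.commute)

lemma cinner_diff_left: "cinner (x - y) (z::'a::complex_hilbert) = cinner x z - cinner y z"
  using cinner_add_left[of x "- y" z] by (simp add: cinner_minus_left)

lemma cinner_diff_right: "cinner x (y - z::'a::complex_hilbert) = cinner x y - cinner x z"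
  using cinner_add_right[of x y "- z"] by (simp add: cinner_minus_right)

lemmas cinner_simps = cinner_add_left cinner_add_right cinner_diff_left cinner_diff_right
  cinner_minus_left cinner_minus_right cinner_zero_left cinner_zero_right
  cinner_scaleC_left cinner_scaleC_right

lemma cinner_self: "cinner x (x::'a::complex_hilbert) = complex_of_real ((norm x)\<^sup>2)"
proof -
  obtain r where "cinner x x = complex_of_real r" "r \<ge> 0"
    using cinner_self_nonneg[of x] by (metis nonneg_Reals_cases)
  then show ?thesis by (simp add: norm_eq_sqrt_cinner)
qed

lemma power2_norm_eq_cinner: "(norm x)\<^sup>2 = Re (cinner x (x::'a::complex_hilbert))"
  by (simp add: cinner_self)

lemma norm_scaleC: "norm (a *\<^sub>C (x::'a::complex_hilbert)) = cmod a * norm x"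
proof -
  have "complex_of_real ((norm (a *\<^sub>C x))\<^sup>2) = complex_of_real ((cmod a * norm x)\<^sup>2)"
    by (simp only: cinner_self[symmetric] cinner_simps)
      (simp add: cinner_self power_mult_distrib complex_norm_square[of a] mult_ac del: of_real_power)
  then show ?thesis
    by (metis of_real_eq_iff mult_nonneg_nonneg norm_ge_zero power2_eq_iff_nonneg)
qed

lemma norm_diff_sq:
  "(norm (x - y::'a::complex_hilbert))\<^sup>2 = (norm x)\<^sup>2 - 2 * Re (cinner x y) + (norm y)\<^sup>2"
proof -
  have "Re (cinner y x) = Re (cinner x y)" by (metis cinner_commute complex_cnj(1) complex_surj complex.sel(1))
  then show ?thesis by (simp add: power2_norm_eq_cinner cinner_simps)
qed

lemma cinner_cauchy_schwarz: "cmod (cinner x y) \<le> norm x * norm (y::'a::complex_hilbert)"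
proof (cases "y = 0")
  case False
  define k where "k = cinner x y / complex_of_real ((norm y)\<^sup>2)"
  have n: "norm y > 0" using False by simp
  have "0 \<le> (norm (x - k *\<^sub>C y))\<^sup>2" by simp
  also have "\<dots> = (norm x)\<^sup>2 - 2 * Re (cnj k * cinner x y) + (cmod k * norm y)\<^sup>2"
    by (simp add: norm_diff_sq cinner_simps norm_scaleC)
  also have "cnj k * cinner x y = complex_of_real ((cmod (cinner x y))\<^sup>2 / (norm y)\<^sup>2)"
    unfolding k_def of_real_divide complex_norm_square by (simp add: mult.commute)
  also have "(cmod k * norm y)\<^sup>2 = (cmod (cinner x y))\<^sup>2 / (norm y)\<^sup>2"
    using n by (simp add: k_def norm_divide norm_mult field_simps power2_eq_square)
  finally have "(cmod (cinner x y))\<^sup>2 \<le> (norm x * norm y)\<^sup>2"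
    using n by (simp add: field_simps power_mult_distrib)
  then show ?thesis by (rule power2_le_imp_le) simp
qed (simp add: cinner_simps)

lemma bounded_linear_scaleC: "bounded_linear (\<lambda>x::'a::complex_hilbert. c *\<^sub>C x)"
proof (rule bounded_linear_intro)
  show "c *\<^sub>C r *\<^sub>R x = r *\<^sub>R c *\<^sub>C x" for r and x::'a
    by (simp add: scaleR_scaleC scaleC_scaleC mult.commute)
  show "norm (c *\<^sub>C x) \<le> norm x * cmod c" for x::'a
    by (simp add: norm_scaleC)
qed (simp add: scaleC_add_right)

lemma bounded_linear_cinner_left: "bounded_linear (\<lambda>x::'a::complex_hilbert. cinner x y)"
  by (rule bounded_linear_intro[where K = "norm y"])
    (auto simp: cinner_simps scaleR_scaleC scaleR_conv_of_real intro: cinner_cauchy_schwarz)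

lemma bounded_linear_cinner_right: "bounded_linear (\<lambda>x::'a::complex_hilbert. cinner y x)"
proof (rule bounded_linear_intro[where K = "norm y"])
  show "norm (cinner y x) \<le> norm x * norm y" for x :: 'a
    using cinner_cauchy_schwarz[of y x] by (simp add: mult.commute)
qed (simp_all add: cinner_simps scaleR_scaleC scaleR_conv_of_real)

lemma bounded_operator_simps:
  assumes "bounded_operator T"
  shows "T (x + y) = T x + T y" "T (x - y) = T x - T y" "T (c *\<^sub>C x) = c *\<^sub>C T x" "T 0 = 0"
proof -
  interpret bounded_linear T using assms by (simp add: bounded_operator_def)
  show "T (x + y) = T x + T y" "T (x - y) = T x - T y" "T 0 = 0"
    by (simp_all add: add diff zero)
  show "T (c *\<^sub>C x) = c *\<^sub>C T x" using assms by (simp add: bounded_operator_def)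
qed

lemma bounded_operator_bounded_linear: "bounded_operator T \<Longrightarrow> bounded_linear T"
  by (simp add: bounded_operator_def)

lemma bounded_operator_shift:
  assumes "bounded_operator T"
  shows "bounded_operator (\<lambda>x. k *\<^sub>C (T x - \<mu> *\<^sub>C x))"
  unfolding bounded_operator_def
proof (intro conjI allI)
  show "bounded_linear (\<lambda>x. k *\<^sub>C (T x - \<mu> *\<^sub>C x))"
    by (intro bounded_linear_compose[OF bounded_linear_scaleC] bounded_linear_sub
        bounded_operator_bounded_linear[OF assms] bounded_linear_scaleC)
  show "k *\<^sub>C (T (c *\<^sub>C x) - \<mu> *\<^sub>C c *\<^sub>C x) = c *\<^sub>C k *\<^sub>C (T x - \<mu> *\<^sub>C x)" for c x
    by (simp add: bounded_operator_simps[OF assms] complex_vector.scale_right_diff_distrib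
        scaleC_scaleC mult_ac)
qed

lemma cinner_eqI: "(\<And>z. cinner z x = cinner z y) \<Longrightarrow> x = (y::'a::complex_hilbert)"
  by (metis cinner_diff_right cinner_self_eq_0 eq_iff_diff_eq_0)

subsection \<open>Orthonormal bases and adjoints\<close>

lemma orthonormal_basis_cinner:
  "orthonormal_basis e \<Longrightarrow> cinner (e m) (e n) = (if m = n then 1 else 0)"
  by (simp add: orthonormal_basis_def)

lemma orthonormal_basis_closed_subspace:
  assumes "orthonormal_basis e" "complex_vector.subspace C" "closed C" "\<And>n. e n \<in> C"
  shows "x \<in> C"
proof -
  have "closure (complex_vector.span (range e)) \<subseteq> C"
    using assms by (intro closure_minimal complex_vector.span_minimal) auto
  then show ?thesis using assms(1) by (auto simp: orthonormal_basis_def)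
qed

lemma orthonormal_basis_functional_eq:
  fixes F G :: "'a::complex_hilbert \<Rightarrow> complex"
  assumes "orthonormal_basis (e :: nat \<Rightarrow> 'a)" "bounded_linear F" "bounded_linear G"
    and "\<And>c x. F (c *\<^sub>C x) = c * F x" "\<And>c x. G (c *\<^sub>C x) = c * G x"
    and "\<And>n. F (e n) = G (e n)"
  shows "F x = G x"
proof -
  interpret F: bounded_linear F by fact
  interpret G: bounded_linear G by fact
  have "x \<in> {x. F x = G x}"
  proof (rule orthonormal_basis_closed_subspace[OF assms(1)])
    show "complex_vector.subspace {x. F x = G x}"
      by (rule complex_vector.subspaceI) (auto simp: F.add G.add F.zero G.zero assms(4,5))
    show "closed {x. F x = G x}"
      by (intro closed_Collect_eq linear_continuous_on assms(2,3))
  qed (simp add: assms)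
  then show ?thesis by simp
qed

lemma orthonormal_basis_operator_eq:
  assumes "orthonormal_basis e" "bounded_operator F" "bounded_operator G" "\<And>n. F (e n) = G (e n)"
  shows "F x = G x"
proof -
  note FG = bounded_operator_simps[OF assms(2)] bounded_operator_simps[OF assms(3)]
  have "x \<in> {x. F x = G x}"
  proof (rule orthonormal_basis_closed_subspace[OF assms(1)])
    show "complex_vector.subspace {x. F x = G x}"
      by (rule complex_vector.subspaceI) (auto simp: FG)
    show "closed {x. F x = G x}"
      using assms(2,3)[THEN bounded_operator_bounded_linear]
      by (intro closed_Collect_eq linear_continuous_on)
  qed (simp add: assms)
  then show ?thesis by simp
qed

lemma orthonormal_basis_eqI:
  assumes "orthonormal_basis e" "\<And>n. cinner x (e n) = cinner y (e n)"
  shows "x = y"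
proof (rule cinner_eqI)
  have *: "cinner (e n) x = cinner (e n) y" for n
    by (simp add: cinner_commute[of "e n" x] cinner_commute[of "e n" y] assms(2))
  show "cinner z x = cinner z y" for z
    by (rule orthonormal_basis_functional_eq[OF assms(1) bounded_linear_cinner_left bounded_linear_cinner_left])
      (simp_all add: cinner_simps *)
qed

lemma norm_orthonormal_sum_sq:
  assumes "orthonormal_basis e" "finite I"
  shows "(norm (\<Sum>i\<in>I. f i *\<^sub>C e i))\<^sup>2 = (\<Sum>i\<in>I. (cmod (f i))\<^sup>2)"
  using assms(2)
proof induction
  case (insert i I)
  have "cinner (\<Sum>i\<in>I. f i *\<^sub>C e i) (e i) = (\<Sum>j\<in>I. cinner (f j *\<^sub>C e j) (e i))"
    by (rule bounded_linear.linear[OF bounded_linear_cinner_left, THEN linear_sum])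
  also have "\<dots> = 0"
    using insert(2) by (intro sum.neutral) (auto simp: cinner_simps orthonormal_basis_cinner[OF assms(1)])
  finally have 0: "cinner (\<Sum>i\<in>I. f i *\<^sub>C e i) (e i) = 0" .
  then have 1: "cinner (e i) (\<Sum>i\<in>I. f i *\<^sub>C e i) = 0"
    by (metis cinner_commute complex_cnj_zero)
  have 2: "Re (f i * cnj (f i)) = (cmod (f i))\<^sup>2"
    by (metis Re_complex_of_real complex_norm_square)
  have "(norm (f i *\<^sub>C e i + (\<Sum>i\<in>I. f i *\<^sub>C e i)))\<^sup>2
    = (cmod (f i))\<^sup>2 + (norm (\<Sum>i\<in>I. f i *\<^sub>C e i))\<^sup>2"
    unfolding power2_norm_eq_cinner cinner_simps 0 1
    using 2 by (simp add: orthonormal_basis_cinner[OF assms(1)] mult.commute)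
  then show ?case using insert by simp
qed simp

text \<open>The representing vector is the series with coefficients \<open>cnj (F (e n))\<close>.
  Testing \<open>F\<close> on a partial sum \<open>s I\<close> gives
  \<open>cmod (F (s I)) = (norm (s I))\<^sup>2\<close>, hence \<open>norm (s I) \<le> K\<close>. So
  the coefficients are square summable, and orthonormality turns their Cauchy tails into Cauchy
  tails of vectors.\<close>

lemma riesz_representation:
  fixes F :: "'a::complex_hilbert \<Rightarrow> complex"
  assumes e: "orthonormal_basis (e :: nat \<Rightarrow> 'a)" and "bounded_linear F" and F: "\<And>c x. F (c *\<^sub>C x) = c * F x"
  shows "\<exists>z. \<forall>x. F x = cinner x z"
proof -
  interpret F: bounded_linear F by fact
  obtain K where K: "K \<ge> 0" "\<And>x. cmod (F x) \<le> norm x * K" using F.nonneg_bounded by blast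
  define f where "f n = cnj (F (e n))" for n
  define s where "s I = (\<Sum>i\<in>I. f i *\<^sub>C e i)" for I
  have s: "(norm (s I))\<^sup>2 = (\<Sum>i\<in>I. (cmod (f i))\<^sup>2)" if "finite I" for I
    unfolding s_def by (rule norm_orthonormal_sum_sq[OF e that])
  have le: "(\<Sum>i\<in>I. (cmod (f i))\<^sup>2) \<le> K\<^sup>2" if "finite I" for I
  proof -
    have "F (s I) = (\<Sum>i\<in>I. complex_of_real ((cmod (f i))\<^sup>2))"
      unfolding s_def F.sum F f_def complex_norm_square by (simp add: mult.commute)
    then have "cmod (F (s I)) = (norm (s I))\<^sup>2"
      unfolding s[OF that] of_real_sum[symmetric] by (simp only: norm_of_real) (simp add: sum_nonneg)
    then have "norm (s I) * norm (s I) \<le> norm (s I) * K" using K(2)[of "s I"] by (simp add: power2_eq_square)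
    then have "norm (s I) \<le> K" using K(1) by (cases "norm (s I) = 0") auto
    then show ?thesis using s[OF that] by (metis norm_ge_zero power_mono)
  qed
  have summ: "summable (\<lambda>i. (cmod (f i))\<^sup>2)"
    by (rule summableI_nonneg_bounded[of _ "K\<^sup>2"]) (use le in auto)
  have "summable (\<lambda>i. f i *\<^sub>C e i)"
    unfolding summable_Cauchy
  proof (intro allI impI)
    fix \<epsilon> :: real assume "\<epsilon> > 0"
    then have "\<epsilon>\<^sup>2 > 0" by simp
    then obtain N where N: "\<And>m n. m \<ge> N \<Longrightarrow> norm (\<Sum>i\<in>{m..<n}. (cmod (f i))\<^sup>2) < \<epsilon>\<^sup>2"
      using summ unfolding summable_Cauchy by blast
    have "norm (\<Sum>i\<in>{m..<n}. f i *\<^sub>C e i) < \<epsilon>" if "m \<ge> N" for m n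
    proof -
      have "(norm (s {m..<n}))\<^sup>2 < \<epsilon>\<^sup>2" using N[OF that, of n] s[of "{m..<n}"] by simp
      then show ?thesis using \<open>\<epsilon> > 0\<close> by (simp add: s_def power_less_imp_less_base)
    qed
    then show "\<exists>N. \<forall>m\<ge>N. \<forall>n. norm (\<Sum>i\<in>{m..<n}. f i *\<^sub>C e i) < \<epsilon>" by blast
  qed
  define z where "z = (\<Sum>i. f i *\<^sub>C e i)"
  have *: "F (e n) = cinner (e n) z" for n
  proof -
    have "cinner (e n) z = (\<Sum>i. cinner (e n) (f i *\<^sub>C e i))"
      unfolding z_def by (rule bounded_linear.suminf[OF bounded_linear_cinner_right]) fact
    also have "\<dots> = (\<Sum>i\<in>{n}. cinner (e n) (f i *\<^sub>C e i))"
      by (rule suminf_finite) (auto simp: cinner_simps orthonormal_basis_cinner[OF e])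
    also have "\<dots> = F (e n)"
      by (simp add: cinner_simps orthonormal_basis_cinner[OF e] f_def)
    finally show ?thesis ..
  qed
  have "F x = cinner x z" for x
    by (rule orthonormal_basis_functional_eq[OF e assms(2) bounded_linear_cinner_left])
      (simp_all add: cinner_simps F *)
  then show ?thesis by blast
qed

text \<open>Justifies the definite description: Riesz gives the value at each \<open>y\<close>,
  nondegeneracy of the inner product gives linearity and uniqueness, and the bound comes from
  \<open>(norm (S y))\<^sup>2 = cmod (cinner (T (S y)) y)\<close>.\<close>

lemma hilbert_adjoint:
  fixes T :: "'a::complex_hilbert \<Rightarrow> 'a"
  assumes e: "orthonormal_basis (e :: nat \<Rightarrow> 'a)" and T: "bounded_operator T"
  shows bounded_operator_hilbert_adjoint: "bounded_operator (hilbert_adjoint T)"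
    and cinner_hilbert_adjoint: "cinner (T x) y = cinner x (hilbert_adjoint T y)"
proof -
  let ?P = "\<lambda>S. bounded_operator S \<and> (\<forall>x y. cinner (T x) y = cinner x (S y))"
  have "\<exists>z. \<forall>x. cinner (T x) y = cinner x z" for y
    using T by (intro riesz_representation[OF e])
      (auto simp: cinner_simps bounded_operator_simps
        intro!: bounded_linear_compose[OF bounded_linear_cinner_left] bounded_operator_bounded_linear)
  then obtain S where S: "\<And>x y. cinner (T x) y = cinner x (S y)" by metis
  have add: "S (x + y) = S x + S y" for x y
    by (rule cinner_eqI) (simp add: cinner_simps S[symmetric])
  have scale: "S (c *\<^sub>C x) = c *\<^sub>C S x" for c x
    by (rule cinner_eqI) (simp add: cinner_simps S[symmetric])
  obtain K where K: "K \<ge> 0" "\<And>x. norm (T x) \<le> norm x * K"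
    using bounded_linear.nonneg_bounded[OF bounded_operator_bounded_linear[OF T]] by blast
  have "norm (S y) \<le> norm y * K" for y
  proof -
    have "(norm (S y))\<^sup>2 = cmod (cinner (T (S y)) y)"
      unfolding S cinner_self norm_of_real by simp
    also have "\<dots> \<le> norm (T (S y)) * norm y" by (rule cinner_cauchy_schwarz)
    also have "\<dots> \<le> norm (S y) * K * norm y" by (intro mult_right_mono K) auto
    finally have "norm (S y) * norm (S y) \<le> norm (S y) * (norm y * K)"
      by (simp add: power2_eq_square mult_ac)
    then show ?thesis using K(1) by (cases "norm (S y) = 0") auto
  qed
  then have "bounded_operator S"
    unfolding bounded_operator_def
    using add scale by (auto simp: scaleR_scaleC intro!: bounded_linear_intro[of S K])
  with S have "?P S" by simp
  moreover have "S' = S" if "?P S'" for S'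
    using that S by (metis cinner_eqI ext)
  ultimately have "?P (hilbert_adjoint T)"
    unfolding hilbert_adjoint_def by (rule theI)
  then show "bounded_operator (hilbert_adjoint T)" "cinner (T x) y = cinner x (hilbert_adjoint T y)"
    by blast+
qed

subsection \<open>Two sources of hyperinvariant subspaces\<close>

text \<open>The subspace contains the range of \<open>T - \<mu>\<close> but not \<open>x\<close>.\<close>

lemma hyperinvariant_of_adjoint_eigenvector:
  fixes T :: "'a::complex_hilbert \<Rightarrow> 'a"
  assumes T: "bounded_operator T" and ns: "\<not> (\<exists>c. T = (\<lambda>x. c *\<^sub>C x))"
    and x: "x \<noteq> 0" "\<And>y. cinner (T y) x = \<mu> * cinner y x"
  shows "\<exists>M. hyperinvariant T M \<and> M \<noteq> {0} \<and> M \<noteq> UNIV"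
proof -
  define \<C> where "\<C> = {S. bounded_operator S \<and> S \<circ> T = T \<circ> S}"
  \<comment> \<open>All vectors whose orbit under the commutant is orthogonal to \<open>x\<close>.
    Invariance is automatic because the commutant is closed under composition.\<close>
  define M where "M = {y. \<forall>S\<in>\<C>. cinner (S y) x = 0}"
  have lin: "S (y + z) = S y + S z" "S (c *\<^sub>C y) = c *\<^sub>C S y" "S 0 = 0" "S (y - z) = S y - S z"
    "S (T y) = T (S y)" if "S \<in> \<C>" for S y z c
    using that bounded_operator_simps[of S] by (auto simp: \<C>_def o_def fun_eq_iff)
  have comp: "S \<circ> S' \<in> \<C>" if "S \<in> \<C>" "S' \<in> \<C>" for S S'
    using that unfolding \<C>_def bounded_operator_def
    by (auto simp: o_def fun_eq_iff intro: bounded_linear_compose)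
  have "complex_vector.subspace M"
    by (rule complex_vector.subspaceI) (auto simp: M_def lin cinner_simps)
  moreover have "closed M"
  proof -
    have "M = (\<Inter>S\<in>\<C>. {y. cinner (S y) x = 0})" by (auto simp: M_def)
    moreover have "closed {y. cinner (S y) x = 0}" if "S \<in> \<C>" for S
      using that unfolding \<C>_def
      by (intro closed_Collect_eq continuous_on_const linear_continuous_on
          bounded_linear_compose[OF bounded_linear_cinner_left] bounded_operator_bounded_linear) auto
    ultimately show ?thesis by auto
  qed
  moreover have "S ` M \<subseteq> M" if "S \<in> \<C>" for S
    using comp[OF _ that] by (fastforce simp: M_def)
  ultimately have "hyperinvariant T M"
    unfolding hyperinvariant_def by (auto simp: \<C>_def)
  moreover have "M \<noteq> UNIV"
  proof -
    have "id \<in> \<C>" by (auto simp: \<C>_def bounded_operator_def id_def bounded_linear_ident)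
    then have "x \<notin> M" using x(1) by (force simp: M_def cinner_self_eq_0)
    then show ?thesis by auto
  qed
  moreover have "M \<noteq> {0}"
  proof -
    obtain y where "T y \<noteq> \<mu> *\<^sub>C y" using ns by blast
    \<comment> \<open>Commuting \<open>S\<close> past \<open>T - \<mu>\<close> puts the image in the
      range of \<open>T - \<mu>\<close>, which is orthogonal to \<open>x\<close>.\<close>
    moreover have "T y - \<mu> *\<^sub>C y \<in> M"
      by (auto simp: M_def lin cinner_simps x(2))
    ultimately show ?thesis by auto
  qed
  ultimately show ?thesis by blast
qed

text \<open>Passes from an auxiliary operator \<open>A\<close> built out of \<open>T\<close> back to
  \<open>T\<close>: the commutant of \<open>T\<close> is the smaller one, so fewer operators have to
  preserve \<open>M\<close>.\<close>

lemma hyperinvariant_of_commutant_subset: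
  assumes "hyperinvariant A M"
    and "\<And>S. bounded_operator S \<Longrightarrow> S \<circ> T = T \<circ> S \<Longrightarrow> S \<circ> A = A \<circ> S"
  shows "hyperinvariant T M"
  using assms(1) unfolding hyperinvariant_def by (simp add: assms(2))

lemma convergent_of_summable_diff:
  fixes f :: "nat \<Rightarrow> 'a::banach"
  assumes "summable (\<lambda>n. norm (f (Suc n) - f n))"
  shows "convergent f"
proof -
  have "convergent (\<lambda>m. (\<Sum>n<m. f (Suc n) - f n) + f 0)"
    using summable_norm_cancel[OF assms] by (intro convergent_add convergent_const) (simp add: summable_iff_convergent)
  then show ?thesis by (simp add: sum_lessThan_telescope)
qed

text \<open>Iterating \<open>B \<mapsto> (C + B\<^sup>2) / 2\<close> from \<open>0\<close> converges in norm because the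
  increments are dominated by those of the scalar iteration with \<open>C = 1\<close>, which is
  increasing and bounded.\<close>

lemma contraction_sqrt:
  fixes C :: "'a::banach \<Rightarrow>\<^sub>L 'a"
  assumes C: "norm C \<le> 1"
  obtains B where "norm B \<le> 1" "2 *\<^sub>R B = C + (B o\<^sub>L B)"
    "\<And>S x. bounded_linear S \<Longrightarrow> (\<And>x. C (S x) = S (C x)) \<Longrightarrow> B (S x) = S (B x)"
proof -
  \<comment> \<open>The fixed-point equation \<open>2 B = C + B\<^sup>2\<close> says
    \<open>(1 - B)\<^sup>2 = 1 - C\<close>, so \<open>1 - B\<close> will be a square root of
    \<open>1 - C\<close>.\<close>
  define B :: "nat \<Rightarrow> 'a \<Rightarrow>\<^sub>L 'a" where "B = rec_nat 0 (\<lambda>_ B. (1/2) *\<^sub>R (C + (B o\<^sub>L B)))"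
  define \<beta> :: "nat \<Rightarrow> real" where "\<beta> = rec_nat 0 (\<lambda>_ b. (1 + b * b) / 2)"
  have B: "B 0 = 0" "B (Suc n) = (1/2) *\<^sub>R (C + (B n o\<^sub>L B n))" for n by (simp_all only: B_def old.nat.rec)
  have \<beta>: "\<beta> 0 = 0" "\<beta> (Suc n) = (1 + \<beta> n * \<beta> n) / 2" for n by (simp_all add: \<beta>_def)
  have \<beta>01: "0 \<le> \<beta> n \<and> \<beta> n \<le> 1" for n
    by (induction n) (auto simp: \<beta> mult_le_one)
  have "\<beta> (Suc n) - \<beta> n = (1 - \<beta> n)\<^sup>2 / 2" for n
    by (simp add: \<beta> power2_eq_square field_simps)
  then have "incseq \<beta>" by (intro incseq_SucI) (metis diff_ge_0_iff_ge zero_le_power2 zero_le_divide_iff zero_le_numeral)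
  moreover have "Bseq \<beta>" using \<beta>01 by (intro BseqI'[of _ 1]) auto
  ultimately have "convergent \<beta>" by (intro Bseq_monoseq_convergent incseq_imp_monoseq)
  then have summ: "summable (\<lambda>n. \<beta> (Suc n) - \<beta> n)"
    by (auto simp: convergent_def intro: telescope_summable)
  have nB: "norm (B n) \<le> \<beta> n" for n
  proof (induction n)
    case (Suc n)
    have "norm (B n o\<^sub>L B n) \<le> \<beta> n * \<beta> n"
      by (rule order_trans[OF norm_blinfun_compose]) (intro mult_mono Suc.IH, use \<beta>01 in auto)
    then have "norm (C + (B n o\<^sub>L B n)) \<le> 1 + \<beta> n * \<beta> n" using C norm_triangle_ineq[of C "B n o\<^sub>L B n"] by linarith
    then show ?case by (simp add: B \<beta>)
  qed (simp add: B \<beta>)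
  have commS: "B n (S x) = S (B n x)" if S: "bounded_linear S" "\<And>x. C (S x) = S (C x)" for n S x
  proof -
    interpret S: bounded_linear S by fact
    show ?thesis
      by (induction n arbitrary: x)
        (auto simp: B blinfun.bilinear_simps S(2) S.add S.scaleR S.zero)
  qed
  \<comment> \<open>\<open>commS\<close> is used twice: \<open>B n\<close> commutes with
    \<open>C\<close>, hence qualifies as an \<open>S\<close> for \<open>B m\<close>.\<close>
  have comm: "B m (B n x) = B n (B m x)" for m n x
    by (intro commS blinfun.bounded_linear_right commS[symmetric]) simp
  have diff: "norm (B (Suc n) - B n) \<le> \<beta> (Suc n) - \<beta> n" for n
  proof (induction n)
    case 0
    show ?case using nB[of 1] by (simp add: B \<beta>)
  next
    case (Suc n)
    \<comment> \<open>The difference of squares factors only because consecutive iterates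
      commute.\<close>
    have "B (Suc (Suc n)) - B (Suc n) = (1/2) *\<^sub>R ((B (Suc n) + B n) o\<^sub>L (B (Suc n) - B n))"
    proof (rule blinfun_eqI)
      fix x
      have "(B (Suc (Suc n)) - B (Suc n)) x = (1/2) *\<^sub>R (B (Suc n) (B (Suc n) x) - B n (B n x))"
        by (simp only: B(2)[of "Suc n"] B(2)[of n]) (simp add: blinfun.bilinear_simps algebra_simps)
      also have "\<dots> = ((1/2) *\<^sub>R ((B (Suc n) + B n) o\<^sub>L (B (Suc n) - B n))) x"
        using comm[of "Suc n" n x] by (simp add: blinfun.bilinear_simps algebra_simps)
      finally show "(B (Suc (Suc n)) - B (Suc n)) x = \<dots>" .
    qed
    moreover have "norm ((B (Suc n) + B n) o\<^sub>L (B (Suc n) - B n)) \<le> (\<beta> (Suc n) + \<beta> n) * (\<beta> (Suc n) - \<beta> n)"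
      by (rule order_trans[OF norm_blinfun_compose])
        (intro mult_mono Suc.IH order_trans[OF norm_triangle_ineq] add_mono nB, use \<beta>01 in \<open>auto simp: add_nonneg_nonneg\<close>)
    moreover have "\<beta> (Suc (Suc n)) - \<beta> (Suc n) = (\<beta> (Suc n) + \<beta> n) * (\<beta> (Suc n) - \<beta> n) / 2"
      by (simp only: \<beta>(2)[of "Suc n"]) (simp add: \<beta>(2)[of n] field_simps)
    ultimately show ?case by simp
  qed
  have "convergent B"
    by (rule convergent_of_summable_diff, rule summable_comparison_test'[OF summ]) (use diff in simp)
  then obtain L where L: "B \<longlonglongrightarrow> L" by (auto simp: convergent_def)
  show ?thesis
  proof
    show "norm L \<le> 1"
      by (rule Lim_bounded[OF tendsto_norm[OF L], of 0]) (use nB \<beta>01 order_trans in blast)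
    have "(\<lambda>n. 2 *\<^sub>R B (Suc n)) \<longlonglongrightarrow> 2 *\<^sub>R L"
      by (intro tendsto_intros LIMSEQ_Suc L)
    moreover have "(\<lambda>n. 2 *\<^sub>R B (Suc n)) \<longlonglongrightarrow> C + (L o\<^sub>L L)"
      by (simp only: B(2), simp, intro tendsto_intros L bounded_bilinear.tendsto[OF bounded_bilinear_blinfun_compose])
    ultimately show "2 *\<^sub>R L = C + (L o\<^sub>L L)" by (rule LIMSEQ_unique)
    show "L (S x) = S (L x)" if S: "bounded_linear S" "\<And>x. C (S x) = S (C x)" for S x
    proof (rule LIMSEQ_unique)
      show "(\<lambda>n. B n (S x)) \<longlonglongrightarrow> L (S x)" by (intro blinfun.tendsto L tendsto_const)
      show "(\<lambda>n. B n (S x)) \<longlonglongrightarrow> S (L x)"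
        by (simp only: commS[OF S], intro bounded_linear.tendsto[OF S(1)] blinfun.tendsto L tendsto_const)
    qed
  qed
qed

text \<open>The subspace is the kernel of \<open>R - A\<close>, where \<open>R = \<bar>A\<bar>\<close>: since \<open>(R - A) (R + A) = 0\<close>,
  it is nontrivial unless \<open>R\<close> is \<open>A\<close> or \<open>- A\<close>. In these cases
  \<open>cinner (R u) u = 0\<close>, which forces \<open>R u = 0\<close>.\<close>

lemma hyperinvariant_of_selfadjoint:
  fixes A :: "'a::complex_hilbert \<Rightarrow> 'a"
  assumes A: "bounded_operator A" and sym: "\<And>x y. cinner (A x) y = cinner x (A y)"
    and contr: "\<And>x. norm (A x) \<le> norm x"
    and u: "cinner (A u) u = 0" "A u \<noteq> 0"
  shows "\<exists>M. hyperinvariant A M \<and> M \<noteq> {0} \<and> M \<noteq> UNIV"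
proof -
  note Al = bounded_operator_simps[OF A]
  have blA: "bounded_linear A" using A by (rule bounded_operator_bounded_linear)
  \<comment> \<open>With \<open>C = 1 - A\<^sup>2\<close> the square root \<open>1 - B\<close>
    squares to \<open>A\<^sup>2\<close>. Symmetry and contractivity of \<open>A\<close> make
    \<open>C\<close> a contraction.\<close>
  define C where "C = Blinfun (\<lambda>x. x - A (A x))"
  have C: "C x = x - A (A x)" for x
    unfolding C_def
    by (subst bounded_linear_Blinfun_apply)
      (intro bounded_linear_sub bounded_linear_ident bounded_linear_compose[OF blA] blA, rule refl)
  have "norm C \<le> 1"
  proof (rule norm_blinfun_bound)
    fix x
    have "Re (cinner x (A (A x))) = (norm (A x))\<^sup>2"
      by (simp add: sym[symmetric] cinner_self)
    then have "(norm (C x))\<^sup>2 = (norm x)\<^sup>2 - 2 * (norm (A x))\<^sup>2 + (norm (A (A x)))\<^sup>2"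
      by (simp add: C norm_diff_sq)
    also have "\<dots> \<le> (norm x)\<^sup>2"
      using power_mono[OF contr[of "A x"] norm_ge_zero, of 2] zero_le_power2[of "norm (A x)"] by linarith
    finally have "norm (C x) \<le> norm x" by (rule power2_le_imp_le) simp
    then show "norm (C x) \<le> 1 * norm x" by simp
  qed simp
  then obtain B where B: "norm B \<le> 1" "2 *\<^sub>R B = C + (B o\<^sub>L B)"
    and commC: "\<And>S x. bounded_linear S \<Longrightarrow> (\<And>x. C (S x) = S (C x)) \<Longrightarrow> B (S x) = S (B x)"
    using contraction_sqrt by blast
  have comm: "B (S x) = S (B x)" if "bounded_linear S" "\<And>x. A (S x) = S (A x)" for S x
  proof (rule commC[OF that(1)])
    interpret S: bounded_linear S by fact
    show "C (S x) = S (C x)" for x by (simp add: C S.diff that(2))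
  qed
  have BA: "B (A x) = A (B x)" for x by (rule comm[OF blA]) simp
  \<comment> \<open>A \<open>blinfun\<close> is only real linear; complex linearity follows since
    multiplication by \<open>c\<close> commutes with \<open>A\<close>.\<close>
  have Bc: "B (c *\<^sub>C x) = c *\<^sub>C B x" for c x by (rule comm[OF bounded_linear_scaleC]) (simp add: Al)
  define R where "R x = x - B x" for x
  have RR: "R (R x) = A (A x)" for x
  proof -
    have "2 *\<^sub>R B x = x - A (A x) + B (B x)"
      using arg_cong[OF B(2), of "\<lambda>F. blinfun_apply F x"] by (simp add: blinfun.bilinear_simps C)
    then show ?thesis by (simp add: R_def blinfun.bilinear_simps scaleR_2 algebra_simps)
  qed
  have RA: "R (A x) = A (R x)" for x by (simp add: R_def BA Al)
  have Rl: "R (x + y) = R x + R y" "R (c *\<^sub>C x) = c *\<^sub>C R x" "R 0 = 0" for x y c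
    by (simp_all add: R_def blinfun.bilinear_simps Bc complex_vector.scale_right_diff_distrib)
  \<comment> \<open>Equality case of Cauchy-Schwarz: \<open>norm (B u) \<le> norm u\<close> and
    \<open>cinner (B u) u = cinner u u\<close> force \<open>B u = u\<close>. The bound on
    \<open>B\<close> thus plays the part of positivity of \<open>R\<close>.\<close>
  have Ru: "R u = 0" if "cinner (R u) u = 0"
  proof -
    have "norm (B u) \<le> norm u" using norm_blinfun[of B u] B(1)
      by (smt (verit) mult_left_le_one_le norm_ge_zero)
    then have "(norm (B u))\<^sup>2 \<le> (norm u)\<^sup>2" by (simp add: power_mono)
    moreover have "cinner (B u) u = cinner u u" using that by (simp add: R_def cinner_simps)
    then have "Re (cinner (B u) u) = (norm u)\<^sup>2" by (simp add: cinner_self)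
    ultimately have "(norm (B u - u))\<^sup>2 \<le> 0" by (simp add: norm_diff_sq)
    then show ?thesis by (simp add: R_def)
  qed
  define M where "M = {x. R x = A x}"
  have "complex_vector.subspace M"
    by (rule complex_vector.subspaceI) (auto simp: M_def Rl Al)
  moreover have "closed M"
    unfolding M_def R_def
    by (intro closed_Collect_eq continuous_intros linear_continuous_on[OF blA])
  moreover have "S ` M \<subseteq> M" if S: "bounded_operator S" "S \<circ> A = A \<circ> S" for S
  proof -
    have SA: "A (S x) = S (A x)" for x using S(2) by (metis comp_apply)
    have "B (S x) = S (B x)" for x using comm[OF bounded_operator_bounded_linear[OF S(1)] SA] .
    then have "R (S x) = S (R x)" for x by (simp add: R_def bounded_operator_simps[OF S(1)])
    then show ?thesis by (auto simp: M_def SA)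
  qed
  ultimately have "hyperinvariant A M" unfolding hyperinvariant_def by blast
  moreover have "M \<noteq> UNIV"
  proof
    assume "M = UNIV"
    then have "R u = A u" by (auto simp: M_def)
    then show False using Ru u by simp
  qed
  moreover have "M \<noteq> {0}"
  proof
    assume M0: "M = {0}"
    \<comment> \<open>Since \<open>R\<^sup>2 = A\<^sup>2\<close> and \<open>R\<close> commutes with
      \<open>A\<close>, both \<open>R\<close> and \<open>A\<close> send \<open>R u + A u\<close> to
      the same vector.\<close>
    have "R u + A u \<in> M" by (simp add: M_def Rl Al RR RA)
    then have "R u = - A u" using M0 by (simp add: add_eq_0_iff)
    then show False using Ru u by (simp add: cinner_simps)
  qed
  ultimately show ?thesis by blast
qed

subsection \<open>Tridiagonal operators\<close>

text \<open>Summing the inequality bounds a partial sum \<open>S\<close> by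
  \<open>k 0 + k 1 + (p + q) S\<close>, and \<open>p + q < 1\<close> lets the last term be absorbed.
  Passing to \<open>k\<close> discards the terms before \<open>N\<close>.\<close>

lemma summable_of_three_term_bound:
  fixes h :: "nat \<Rightarrow> real"
  assumes h: "\<And>n. h n \<ge> 0" and pq: "p \<ge> 0" "q \<ge> 0" "p + q < 1"
    and rec: "\<And>n. n \<ge> N \<Longrightarrow> h (Suc (Suc n)) \<le> p * h (Suc n) + q * h n"
  shows "summable h"
proof -
  define k where "k n = h (n + N)" for n
  have k: "k n \<ge> 0" "k (Suc (Suc n)) \<le> p * k (Suc n) + q * k n" for n
    using h rec[of "n + N"] by (simp_all add: k_def)
  have mono: "sum k {..<M} \<le> sum k {..<Suc M}" for M using k(1)[of M] by simp
  have "sum k {..<M} \<le> (k 0 + k 1) / (1 - p - q)" for M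
  proof -
    let ?S = "sum k {..<Suc (Suc M)}"
    have "(\<Sum>n<M. k (Suc (Suc n))) \<le> (\<Sum>n<M. p * k (Suc n) + q * k n)"
      by (rule sum_mono) (rule k)
    also have "\<dots> = p * (\<Sum>n<M. k (Suc n)) + q * sum k {..<M}"
      by (simp add: sum.distrib sum_distrib_left)
    also have "\<dots> \<le> p * ?S + q * ?S"
    proof (intro add_mono mult_left_mono pq)
      show "(\<Sum>n<M. k (Suc n)) \<le> ?S"
        using mono[of "Suc M"] k(1)[of 0] by (simp only: sum.lessThan_Suc_shift[of k M])
      show "sum k {..<M} \<le> ?S" using mono[of M] mono[of "Suc M"] by linarith
    qed
    finally have "?S \<le> k 0 + k 1 + (p * ?S + q * ?S)"
      by (simp only: sum.lessThan_Suc_shift One_nat_def)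
    then have "?S * (1 - p - q) \<le> k 0 + k 1" by (simp add: algebra_simps)
    then have "?S \<le> (k 0 + k 1) / (1 - p - q)" using pq by (simp add: pos_le_divide_eq)
    then show ?thesis using mono[of M] mono[of "Suc M"] by linarith
  qed
  then have "summable k" using k(1) by (intro summableI_nonneg_bounded)
  then show ?thesis unfolding k_def by (simp add: summable_iff_shift)
qed

text \<open>Characteristic polynomials of the leading blocks of a tridiagonal matrix with diagonal
  \<open>a\<close>; \<open>w n\<close> is the product of the two off-diagonal entries linking
  \<open>n\<close> and \<open>Suc n\<close>.\<close>

fun jacobi_poly :: "(nat \<Rightarrow> complex) \<Rightarrow> (nat \<Rightarrow> complex) \<Rightarrow> nat \<Rightarrow> complex poly" where
  "jacobi_poly a w 0 = 1"
| "jacobi_poly a w (Suc 0) = [:- a 0, 1:]"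
| "jacobi_poly a w (Suc (Suc n)) =
     [:- a (Suc n), 1:] * jacobi_poly a w (Suc n) - smult (w n) (jacobi_poly a w n)"

text \<open>Ensures nonconstancy, so that the fundamental theorem of algebra supplies a
  root.\<close>

lemma degree_jacobi_poly: "degree (jacobi_poly a w n) = n"
proof (induction a w n rule: jacobi_poly.induct)
  case (3 a w n)
  have "jacobi_poly a w (Suc n) \<noteq> 0" using 3(1) by force
  then have "degree ([:- a (Suc n), 1:] * jacobi_poly a w (Suc n)) = Suc (Suc n)"
    by (subst degree_mult_eq) (auto simp: 3)
  moreover have "degree (smult (w n) (jacobi_poly a w n)) < Suc (Suc n)"
    using 3(2) degree_smult_le[of "w n" "jacobi_poly a w n"] by linarith
  ultimately show ?case
    by (metis degree_add_eq_left degree_minus diff_conv_add_uminus jacobi_poly.simps(3))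
qed simp_all

text \<open>The equation \<open>cinner (T y) x = \<mu> * cinner y x\<close> read at
  \<open>y = e n\<close>, with \<open>g n = cinner (e n) x\<close>; thus \<open>x\<close> is an
  eigenvector of the adjoint.\<close>

definition three_term_solution ::
  "(nat \<Rightarrow> complex) \<Rightarrow> (nat \<Rightarrow> complex) \<Rightarrow> (nat \<Rightarrow> complex) \<Rightarrow> complex \<Rightarrow> (nat \<Rightarrow> complex) \<Rightarrow> bool" where
  "three_term_solution a b c \<mu> g \<longleftrightarrow> b 0 * g 1 = (\<mu> - a 0) * g 0 \<and>
     (\<forall>n. b (Suc n) * g (Suc (Suc n)) = (\<mu> - a (Suc n)) * g (Suc n) - c n * g n)"

text \<open>The recurrence solved forward from \<open>g 0 = 1\<close>: multiplying by the product of
  the \<open>b i\<close> clears denominators and leaves the recurrence of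
  \<open>jacobi_poly\<close>.\<close>

definition jacobi_solution ::
  "(nat \<Rightarrow> complex) \<Rightarrow> (nat \<Rightarrow> complex) \<Rightarrow> (nat \<Rightarrow> complex) \<Rightarrow> complex \<Rightarrow> nat \<Rightarrow> complex" where
  "jacobi_solution a b c \<mu> n = poly (jacobi_poly a (\<lambda>n. b n * c n) n) \<mu> / (\<Prod>i<n. b i)"

lemma jacobi_solution_0: "jacobi_solution a b c \<mu> 0 = 1"
  by (simp add: jacobi_solution_def)

lemma jacobi_solution_three_term:
  assumes "\<And>n. b n \<noteq> 0"
  shows "three_term_solution a b c \<mu> (jacobi_solution a b c \<mu>)"
  using assms by (simp add: three_term_solution_def jacobi_solution_def field_simps)

text \<open>At a zero \<open>b N = 0\<close> the division convention \<open>x / 0 = 0\<close> truncates the solution.\<close>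

lemma jacobi_solution_truncated:
  assumes b: "\<And>n. n < N \<Longrightarrow> b n \<noteq> 0" and N: "b N = 0" "c N = 0"
    and \<mu>: "poly (jacobi_poly a (\<lambda>n. b n * c n) (Suc N)) \<mu> = 0"
  shows "three_term_solution a b c \<mu> (jacobi_solution a b c \<mu>)"
    and "\<And>n. n > N \<Longrightarrow> jacobi_solution a b c \<mu> n = 0"
proof -
  let ?g = "jacobi_solution a b c \<mu>"
  show 0: "?g n = 0" if "n > N" for n
    using that N(1) by (auto simp: jacobi_solution_def)
  have nz: "(\<Prod>i<n. b i) \<noteq> 0" if "n \<le> N" for n using b that by auto
  show "three_term_solution a b c \<mu> ?g"
    unfolding three_term_solution_def
  proof (intro conjI allI)
    show "b 0 * ?g 1 = (\<mu> - a 0) * ?g 0"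
    proof (cases "N = 0")
      case True
      then show ?thesis using \<mu> N(1) by (simp add: jacobi_solution_def)
    next
      case False
      then show ?thesis using b[of 0] by (simp add: jacobi_solution_def)
    qed
    fix n
    have *: "(\<mu> - a (Suc n)) * ?g (Suc n) - c n * ?g n
        = poly (jacobi_poly a (\<lambda>n. b n * c n) (Suc (Suc n))) \<mu> / (\<Prod>i<Suc n. b i)" if "n < N"
      using b[OF that] nz[of n] that by (simp add: jacobi_solution_def field_simps)
    \<comment> \<open>Below \<open>N\<close> this is the polynomial recurrence. At \<open>N\<close>
      the left side vanishes with \<open>b N\<close>, the right side because \<open>\<mu>\<close> is
      a root. Just beyond, \<open>c N = 0\<close> decouples the nonzero part, and afterwards all
      terms vanish.\<close>
    consider "Suc n < N" | "Suc n = N" | "n = N" | "n > N" by linarith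
    then show "b (Suc n) * ?g (Suc (Suc n)) = (\<mu> - a (Suc n)) * ?g (Suc n) - c n * ?g n"
    proof cases
      case 1
      then show ?thesis using b[of "Suc n"] by (subst *) (simp_all add: jacobi_solution_def)
    next
      case 2
      then show ?thesis using \<mu> N(1) by (subst *) (auto simp del: jacobi_poly.simps)
    next
      case 3
      then show ?thesis using N(2) by (simp add: 0)
    next
      case 4
      then show ?thesis by (simp add: 0)
    qed
  qed
qed

section \<open>Matrix coefficients and eigenvectors of the adjoint\<close>

lemma Re_mult_cnj: "Re (z * cnj z) = (cmod z)\<^sup>2"
  by (metis Re_complex_of_real complex_norm_square)

text \<open>\<open>T'\<close> stands for the adjoint. Hyponormality appears as
  \<open>norm (T' x) \<le> norm (T x)\<close>, because the quadratic form of the self-commutator is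
  the difference of the squared norms.\<close>

locale tridiagonal_hyponormal =
  fixes T T' :: "'a::complex_hilbert \<Rightarrow> 'a" and e :: "nat \<Rightarrow> 'a"
  assumes basis: "orthonormal_basis e"
    and T: "bounded_operator T" and T': "bounded_operator T'"
    and adjoint: "cinner (T x) y = cinner x (T' y)"
    and tridiagonal: "\<bar>int m - int n\<bar> \<ge> 2 \<Longrightarrow> cinner (T (e n)) (e m) = 0"
    and norm_adjoint_le: "norm (T' x) \<le> norm (T x)"
begin

definition a :: "nat \<Rightarrow> complex" where "a n = cinner (T (e n)) (e n)"
definition b :: "nat \<Rightarrow> complex" where "b n = cinner (T (e n)) (e (Suc n))"
definition c :: "nat \<Rightarrow> complex" where "c n = cinner (T (e (Suc n))) (e n)"

lemmas e_cinner = orthonormal_basis_cinner[OF basis]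

lemma norm_e: "norm (e n) = 1"
  using cinner_self[of "e n"] by (simp add: e_cinner power2_eq_1_iff flip: of_real_power)
    (smt (verit) norm_ge_zero)

lemma T_entry:
  "cinner (T (e n)) (e m) =
    (if m = n then a n else if m = Suc n then b n else if n = Suc m then c m else 0)"
  using tridiagonal[of m n] by (auto simp: a_def b_def c_def)

lemma T_e_0: "T (e 0) = a 0 *\<^sub>C e 0 + b 0 *\<^sub>C e (Suc 0)"
  by (rule orthonormal_basis_eqI[OF basis]) (auto simp: cinner_simps e_cinner T_entry)

lemma T_e_Suc:
  "T (e (Suc n)) = c n *\<^sub>C e n + a (Suc n) *\<^sub>C e (Suc n) + b (Suc n) *\<^sub>C e (Suc (Suc n))"
  by (rule orthonormal_basis_eqI[OF basis]) (auto simp: cinner_simps e_cinner T_entry)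

lemma T'_entry: "cinner (T' (e n)) (e m) = cnj (cinner (T (e m)) (e n))"
  by (metis adjoint cinner_commute)

lemma T'_e_0: "T' (e 0) = cnj (a 0) *\<^sub>C e 0 + cnj (c 0) *\<^sub>C e (Suc 0)"
  by (rule orthonormal_basis_eqI[OF basis]) (auto simp: cinner_simps e_cinner T'_entry T_entry)

lemma T'_e_Suc:
  "T' (e (Suc n)) =
    cnj (b n) *\<^sub>C e n + cnj (a (Suc n)) *\<^sub>C e (Suc n) + cnj (c (Suc n)) *\<^sub>C e (Suc (Suc n))"
  by (rule orthonormal_basis_eqI[OF basis]) (auto simp: cinner_simps e_cinner T'_entry T_entry)

text \<open>The basis vectors have norm 1, so absolute summability of \<open>g\<close> makes the
  series for \<open>x\<close> converge. The coefficients are conjugated because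
  \<open>cinner\<close> is conjugate linear on the right. The equation holds on the basis, hence
  everywhere by density.\<close>

lemma eigenvector_of_solution:
  assumes g: "three_term_solution a b c \<mu> g" and "g 0 = 1" and summ: "summable (\<lambda>n. cmod (g n))"
  shows "\<exists>x. x \<noteq> 0 \<and> (\<forall>y. cinner (T y) x = \<mu> * cinner y x)"
proof -
  have "summable (\<lambda>n. cnj (g n) *\<^sub>C e n)"
    by (rule summable_norm_cancel) (simp add: norm_scaleC norm_e summ)
  define x where "x = (\<Sum>n. cnj (g n) *\<^sub>C e n)"
  have x: "cinner (e n) x = g n" for n
  proof -
    have "cinner (e n) x = (\<Sum>i. cinner (e n) (cnj (g i) *\<^sub>C e i))"
      unfolding x_def by (rule bounded_linear.suminf[OF bounded_linear_cinner_right]) fact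
    also have "\<dots> = (\<Sum>i\<in>{n}. cinner (e n) (cnj (g i) *\<^sub>C e i))"
      by (rule suminf_finite) (auto simp: cinner_simps e_cinner)
    finally show ?thesis by (simp add: cinner_simps e_cinner)
  qed
  have e: "cinner (T (e n)) x = \<mu> * cinner (e n) x" for n
  proof (cases n)
    case 0
    then show ?thesis using g
      by (simp add: T_e_0 cinner_simps x three_term_solution_def algebra_simps)
  next
    case (Suc k)
    have "b (Suc k) * g (Suc (Suc k)) = (\<mu> - a (Suc k)) * g (Suc k) - c k * g k"
      using g by (simp add: three_term_solution_def)
    then show ?thesis using Suc
      by (simp add: T_e_Suc cinner_simps x algebra_simps)
  qed
  have "bounded_linear (\<lambda>y. cinner (T y) x)"
    by (rule bounded_linear_compose[OF bounded_linear_cinner_left bounded_operator_bounded_linear[OF T]])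
  moreover have "bounded_linear (\<lambda>y. \<mu> * cinner y x)"
    by (rule bounded_linear_compose[OF bounded_linear_mult_right bounded_linear_cinner_left])
  ultimately have "cinner (T y) x = \<mu> * cinner y x" for y
    by (rule orthonormal_basis_functional_eq[OF basis])
      (simp_all add: e cinner_simps bounded_operator_simps[OF T])
  moreover have "x \<noteq> 0" using x[of 0] \<open>g 0 = 1\<close> by (auto simp: cinner_simps)
  ultimately show ?thesis by blast
qed

section \<open>The form \<open>Q x y = cinner (D x) y\<close> of the self-commutator
  \<open>D\<close>, and its matrix\<close>

definition Q :: "'a \<Rightarrow> 'a \<Rightarrow> complex" where
  "Q x y = cinner (T x) (T y) - cinner (T' x) (T' y)"

lemma Re_Q_self: "Re (Q x x) = (norm (T x))\<^sup>2 - (norm (T' x))\<^sup>2"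
  by (simp add: Q_def cinner_self)

lemma Re_Q_self_nonneg: "Re (Q x x) \<ge> 0"
  using power_mono[OF norm_adjoint_le norm_ge_zero, of x 2] by (simp add: Re_Q_self)

text \<open>Cauchy-Schwarz for the positive form \<open>Q\<close>, with an arithmetic mean so that
  summability passes from diagonal to off-diagonal entries. Expand \<open>Q\<close> at
  \<open>x - u *\<^sub>C y\<close>, where \<open>u\<close> is the phase of
  \<open>Q x y\<close>.\<close>

lemma cmod_Q_le: "cmod (Q x y) \<le> (Re (Q x x) + Re (Q y y)) / 2"
proof -
  obtain u where u: "cmod u = 1" "cnj u * Q x y = complex_of_real (cmod (Q x y))"
  proof (cases "Q x y = 0")
    case True
    then show ?thesis using that[of 1] by simp
  next
    case False
    have "cnj (sgn (Q x y)) * Q x y = complex_of_real (cmod (Q x y))"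
      using False by (simp add: sgn_div_norm complex_norm_square mult.commute field_simps
          scaleR_conv_of_real power2_eq_square flip: complex_norm_square)
    then show ?thesis using that[of "sgn (Q x y)"] False by (simp add: norm_sgn)
  qed
  have "Re (Q (x - u *\<^sub>C y) (x - u *\<^sub>C y)) = Re (Q x x) - 2 * Re (cnj u * Q x y) + Re (Q y y)"
    unfolding Re_Q_self
    by (simp add: bounded_operator_simps[OF T] bounded_operator_simps[OF T'] norm_diff_sq norm_scaleC
        u(1) cinner_simps Q_def algebra_simps)
  then show ?thesis using Re_Q_self_nonneg[of "x - u *\<^sub>C y"] u(2) by simp
qed

definition t :: "nat \<Rightarrow> real" where "t n = (cmod (b n))\<^sup>2 - (cmod (c n))\<^sup>2"
definition d :: "nat \<Rightarrow> real" where "d n = Re (Q (e n) (e n))"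

lemma d_nonneg: "d n \<ge> 0"
  by (simp add: d_def Re_Q_self_nonneg)

lemma Q_e_0: "Q (e 0) (e 0) = b 0 * cnj (b 0) - c 0 * cnj (c 0)"
  by (simp add: Q_def T_e_0 T'_e_0 cinner_simps e_cinner)

lemma Q_e_Suc: "Q (e (Suc n)) (e (Suc n)) =
    (b (Suc n) * cnj (b (Suc n)) - c (Suc n) * cnj (c (Suc n))) - (b n * cnj (b n) - c n * cnj (c n))"
  by (simp add: Q_def T_e_Suc T'_e_Suc cinner_simps e_cinner)

lemma d_0: "d 0 = t 0"
  by (simp add: d_def t_def Q_e_0 Re_mult_cnj del: times_complex.sel)

lemma d_Suc: "d (Suc n) = t (Suc n) - t n"
  by (simp add: d_def t_def Q_e_Suc Re_mult_cnj del: times_complex.sel)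

text \<open>This entry controls the increments of \<open>a\<close>; the entry two steps off the
  diagonal controls those of \<open>cnj (c n) / b n\<close>.\<close>

lemma Q_e_off_1:
  "Q (e n) (e (Suc n)) = cnj (c n) * (a n - a (Suc n)) + b n * cnj (a (Suc n) - a n)"
  by (cases n) (simp_all add: Q_def T_e_0 T'_e_0 T_e_Suc T'_e_Suc cinner_simps e_cinner algebra_simps)

lemma Q_e_off_2: "Q (e n) (e (Suc (Suc n))) = b n * cnj (c (Suc n)) - cnj (c n) * b (Suc n)"
  by (cases n) (simp_all add: Q_def T_e_0 T'_e_0 T_e_Suc T'_e_Suc cinner_simps e_cinner algebra_simps)

lemma incseq_t: "incseq t"
  by (rule incseq_SucI) (use d_nonneg d_Suc in \<open>smt (verit)\<close>)

lemma t_nonneg: "t n \<ge> 0"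
  using incseqD[OF incseq_t, of 0 n] d_nonneg[of 0] d_0 by simp

lemma bounded_coefficients:
  obtains K where "K > 0" "\<And>x. norm (T x) \<le> K * norm x" "\<And>n. cmod (b n) \<le> K"
proof -
  obtain K where K: "K > 0" "\<And>x. norm (T x) \<le> norm x * K"
    using bounded_linear.pos_bounded[OF bounded_operator_bounded_linear[OF T]] by blast
  moreover have "cmod (b n) \<le> K" for n
    using cinner_cauchy_schwarz[of "T (e n)" "e (Suc n)"] K(2)[of "e n"] by (simp add: b_def norm_e)
  ultimately show ?thesis using that[of K] by (simp add: mult.commute)
qed

lemma convergent_t: "convergent t"
proof -
  obtain K where K: "\<And>n. cmod (b n) \<le> K" using bounded_coefficients by metis
  have "t n \<le> K\<^sup>2" for n
    using power_mono[OF K[of n] norm_ge_zero, of 2] by (simp add: t_def) (smt (verit) zero_le_power2)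
  then have "Bseq t" using t_nonneg by (intro BseqI'[of _ "K\<^sup>2"]) simp
  then show ?thesis by (intro Bseq_monoseq_convergent incseq_imp_monoseq incseq_t)
qed

lemma summable_d: "summable d"
proof -
  have "summable (\<lambda>n. t (Suc n) - t n)"
    using convergent_t by (auto simp: convergent_def intro: telescope_summable)
  then show ?thesis by (simp flip: d_Suc add: summable_Suc_iff)
qed

lemma summable_Q_off:
  shows "summable (\<lambda>n. cmod (Q (e n) (e (Suc n))))"
    and "summable (\<lambda>n. cmod (Q (e n) (e (Suc (Suc n)))))"
proof -
  have 1: "summable (\<lambda>n. d (Suc n))" using summable_d by (simp add: summable_Suc_iff)
  then have 2: "summable (\<lambda>n. d (Suc (Suc n)))" by (subst summable_Suc_iff)
  show "summable (\<lambda>n. cmod (Q (e n) (e (Suc n))))"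
  proof (rule summable_comparison_test')
    show "summable (\<lambda>n. (d n + d (Suc n)) / 2)" by (intro summable_divide summable_add summable_d 1)
    show "norm (cmod (Q (e n) (e (Suc n)))) \<le> (d n + d (Suc n)) / 2" for n
      unfolding d_def real_norm_def abs_norm_cancel by (rule cmod_Q_le)
  qed
  show "summable (\<lambda>n. cmod (Q (e n) (e (Suc (Suc n)))))"
  proof (rule summable_comparison_test')
    show "summable (\<lambda>n. (d n + d (Suc (Suc n))) / 2)" by (intro summable_divide summable_add summable_d 2)
    show "norm (cmod (Q (e n) (e (Suc (Suc n))))) \<le> (d n + d (Suc (Suc n))) / 2" for n
      unfolding d_def real_norm_def abs_norm_cancel by (rule cmod_Q_le)
  qed
qed

section \<open>Two cases with an eigenvector of the adjoint\<close>

lemma eigenvector_of_zero: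
  assumes "b m = 0"
  shows "\<exists>x \<mu>. x \<noteq> 0 \<and> (\<forall>y. cinner (T y) x = \<mu> * cinner y x)"
proof -
  define N where "N = (LEAST n. b n = 0)"
  have N: "b N = 0" unfolding N_def using assms by (rule LeastI)
  have less: "b n \<noteq> 0" if "n < N" for n using that not_less_Least unfolding N_def by blast
  \<comment> \<open>\<open>t N \<ge> 0\<close> means
    \<open>cmod (c N) \<le> cmod (b N)\<close>.\<close>
  have cN: "c N = 0" using t_nonneg[of N] N by (simp add: t_def)
  have "\<not> constant (poly (jacobi_poly a (\<lambda>n. b n * c n) (Suc N)))"
    by (simp add: constant_degree degree_jacobi_poly)
  then obtain \<mu> where \<mu>: "poly (jacobi_poly a (\<lambda>n. b n * c n) (Suc N)) \<mu> = 0"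
    using fundamental_theorem_of_algebra by blast
  note sol = jacobi_solution_truncated[OF less N cN \<mu>]
  have "summable (\<lambda>n. cmod (jacobi_solution a b c \<mu> n))"
    by (rule summable_finite[of "{..N}"]) (use sol(2) in auto)
  from eigenvector_of_solution[OF sol(1) jacobi_solution_0 this] show ?thesis by blast
qed

lemma eigenvector_of_nonnormal:
  assumes b0: "\<And>n. b n \<noteq> 0" and N: "t N > 0"
  shows "\<exists>x \<mu>. x \<noteq> 0 \<and> (\<forall>y. cinner (T y) x = \<mu> * cinner y x)"
proof -
  \<comment> \<open>As \<open>t\<close> increases, \<open>\<tau>\<close> bounds it below from
    \<open>N\<close> on, which keeps \<open>b n\<close> away from 0.\<close>
  define \<tau> where "\<tau> = t N"
  obtain K where K: "K > 0" "\<And>n. cmod (b n) \<le> K" using bounded_coefficients by metis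
  have \<tau>: "\<tau> > 0" "\<And>n. n \<ge> N \<Longrightarrow> \<tau> \<le> t n"
    using N incseqD[OF incseq_t] by (auto simp: \<tau>_def)
  have b_ge: "sqrt \<tau> \<le> cmod (b n)" if "n \<ge> N" for n
  proof (rule real_le_lsqrt)
    show "\<tau> \<le> (cmod (b n))\<^sup>2"
      using \<tau>(2)[OF that] zero_le_power2[of "cmod (c n)"] unfolding t_def by linarith
  qed simp
  have cb: "cmod (c n) \<le> cmod (b n)" for n
    using t_nonneg[of n] by (simp add: t_def)

  define r where "r n = cnj (c n) / b n" for n
  have "convergent r"
  proof (rule convergent_of_summable_diff, rule summable_comparison_test'[where N = N])
    show "summable (\<lambda>n. cmod (Q (e n) (e (Suc (Suc n)))) / \<tau>)"
      by (intro summable_divide summable_Q_off)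
    fix n assume n: "n \<ge> N"
    have "r (Suc n) - r n = Q (e n) (e (Suc (Suc n))) / (b n * b (Suc n))"
      using b0[of n] b0[of "Suc n"] by (simp add: r_def Q_e_off_2 field_simps)
    moreover have "\<tau> \<le> cmod (b n) * cmod (b (Suc n))"
      using mult_mono[OF b_ge[of n] b_ge[of "Suc n"]] n \<tau> by simp
    ultimately show "norm (norm (r (Suc n) - r n)) \<le> cmod (Q (e n) (e (Suc (Suc n)))) / \<tau>"
      using \<tau> by (simp add: norm_divide norm_mult divide_left_mono mult_pos_pos b0)
  qed
  then obtain r' where "r \<longlonglongrightarrow> r'" by (auto simp: convergent_def)
  define \<rho> where "\<rho> = cmod r'"
  have r: "(\<lambda>n. cmod (r n)) \<longlonglongrightarrow> \<rho>" unfolding \<rho>_def by (rule tendsto_norm) fact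
  have r_sq: "(cmod (b n))\<^sup>2 * (1 - (cmod (r n))\<^sup>2) = t n" for n
    using b0[of n] by (simp add: r_def t_def norm_divide power_divide field_simps)
  \<comment> \<open>Keeps the limit \<open>\<rho>\<close> strictly below 1: by \<open>r_sq\<close>,
    \<open>1 - (cmod (r n))\<^sup>2\<close> is \<open>t n / (cmod (b n))\<^sup>2\<close>, with
    numerator at least \<open>\<tau>\<close> and denominator at most
    \<open>K\<^sup>2\<close>.\<close>
  have "(cmod (r n))\<^sup>2 \<le> 1 - \<tau> / K\<^sup>2" if "n \<ge> N" for n
  proof -
    have "(cmod (b n))\<^sup>2 \<le> K\<^sup>2" using K(2) by (simp add: power_mono)
    moreover have "1 - (cmod (r n))\<^sup>2 \<ge> 0"
      using cb[of n] b0[of n] by (simp add: r_def norm_divide power_le_one divide_le_eq_1)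
    ultimately have "\<tau> \<le> K\<^sup>2 * (1 - (cmod (r n))\<^sup>2)"
      using mult_right_mono \<tau>(2)[OF that] r_sq[of n] by (metis order_trans)
    then show ?thesis using K(1) by (simp add: field_simps)
  qed
  then have "\<rho>\<^sup>2 \<le> 1 - \<tau> / K\<^sup>2"
    by (intro Lim_bounded[OF tendsto_power[OF r], of N]) auto
  also have "\<dots> < 1" using \<tau> K by simp
  finally have \<rho>1: "\<rho>\<^sup>2 < 1" .
  then have \<rho>: "\<rho> < 1" "\<rho> \<ge> 0" by (auto simp: \<rho>_def power_less_one_iff abs_square_less_1)

  obtain t' where t': "t \<longlonglongrightarrow> t'" using convergent_t by (auto simp: convergent_def)
  have "\<tau> \<le> t'" using \<tau>(2) by (intro Lim_bounded2[OF t', of N]) auto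
  \<comment> \<open>The limit of \<open>cmod (b n)\<close>, obtained by solving \<open>r_sq\<close>
    for it and letting \<open>n\<close> tend to infinity.\<close>
  define \<beta> where "\<beta> = sqrt (t' / (1 - \<rho>\<^sup>2))"
  have \<beta>: "\<beta> > 0" using \<tau> \<open>\<tau> \<le> t'\<close> \<rho>1 by (simp add: \<beta>_def)
  have "(\<lambda>n. sqrt (t n / (1 - (cmod (r n))\<^sup>2))) \<longlonglongrightarrow> \<beta>"
    unfolding \<beta>_def using \<rho>1 by (intro tendsto_intros t' r) auto
  moreover have "sqrt (t n / (1 - (cmod (r n))\<^sup>2)) = cmod (b n)" if "n \<ge> N" for n
  proof -
    have "1 - (cmod (r n))\<^sup>2 \<noteq> 0" using r_sq[of n] \<tau>(1) \<tau>(2)[OF that] by auto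
    then have "t n / (1 - (cmod (r n))\<^sup>2) = (cmod (b n))\<^sup>2" by (simp flip: r_sq)
    then show ?thesis by simp
  qed
  then have "\<forall>\<^sub>F n in sequentially. sqrt (t n / (1 - (cmod (r n))\<^sup>2)) = cmod (b n)"
    by (rule eventually_sequentiallyI)
  ultimately have b: "(\<lambda>n. cmod (b n)) \<longlonglongrightarrow> \<beta>"
    by (rule Lim_transform_eventually)
  \<comment> \<open>The recurrence divides \<open>c n\<close> by \<open>b (Suc n)\<close>, not by
    \<open>b n\<close>; convergence of the moduli of \<open>b\<close> absorbs the shift.\<close>
  have "(\<lambda>n. cmod (r n) * cmod (b n) / cmod (b (Suc n))) \<longlonglongrightarrow> \<rho> * \<beta> / \<beta>"
    using \<beta> by (intro tendsto_intros r b LIMSEQ_Suc) auto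
  then have c: "(\<lambda>n. cmod (c n) / cmod (b (Suc n))) \<longlonglongrightarrow> \<rho>"
    using \<beta> b0 by (simp add: r_def norm_divide)

  have "convergent a"
  proof (rule convergent_of_summable_diff, rule summable_comparison_test'[where N = N])
    show "summable (\<lambda>n. (2 * K / \<tau>) * cmod (Q (e n) (e (Suc n))))"
      by (intro summable_mult summable_Q_off)
    fix n assume n: "n \<ge> N"
    \<comment> \<open>The entry has modulus at least
      \<open>(cmod (b n) - cmod (c n)) * cmod ?\<delta>\<close>, and the gap is at least
      \<open>\<tau> / (2 * K)\<close> by factoring \<open>t n\<close>.\<close>
    let ?\<delta> = "a (Suc n) - a n"
    have "\<tau> \<le> (cmod (b n) - cmod (c n)) * (cmod (b n) + cmod (c n))"
      using \<tau>(2)[OF n] by (simp add: t_def power2_eq_square algebra_simps)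
    also have "\<dots> \<le> (cmod (b n) - cmod (c n)) * (2 * K)"
      using K(2)[of n] cb[of n] by (intro mult_left_mono) auto
    finally have *: "\<tau> * cmod ?\<delta> \<le> (cmod (b n) - cmod (c n)) * (2 * K) * cmod ?\<delta>"
      by (simp add: mult_right_mono)
    have "(cmod (b n) - cmod (c n)) * cmod ?\<delta> \<le> cmod (Q (e n) (e (Suc n)))"
    proof -
      have "Q (e n) (e (Suc n)) = b n * cnj ?\<delta> - cnj (c n) * ?\<delta>"
        by (simp add: Q_e_off_1 algebra_simps)
      then show ?thesis
        using norm_triangle_ineq2[of "b n * cnj ?\<delta>" "cnj (c n) * ?\<delta>"]
        by (simp add: norm_mult left_diff_distrib flip: complex_cnj_diff)
    qed
    then have "2 * K * ((cmod (b n) - cmod (c n)) * cmod ?\<delta>) \<le> 2 * K * cmod (Q (e n) (e (Suc n)))"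
      using K(1) by (intro mult_left_mono) auto
    with * have "\<tau> * cmod ?\<delta> \<le> 2 * K * cmod (Q (e n) (e (Suc n)))"
      by (simp only: mult_ac)
    then show "norm (norm ?\<delta>) \<le> (2 * K / \<tau>) * cmod (Q (e n) (e (Suc n)))"
      using \<tau>(1) by (simp add: field_simps)
  qed
  then obtain \<alpha> where "a \<longlonglongrightarrow> \<alpha>" by (auto simp: convergent_def)
  then have "(\<lambda>n. cmod (\<alpha> - a (Suc n)) / cmod (b (Suc n))) \<longlonglongrightarrow> cmod (\<alpha> - \<alpha>) / \<beta>"
    using \<beta> by (intro tendsto_intros LIMSEQ_Suc b) auto
  then have a: "(\<lambda>n. cmod (\<alpha> - a (Suc n)) / cmod (b (Suc n))) \<longlonglongrightarrow> 0" by simp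

  \<comment> \<open>A third of the gap, so that the limiting coefficients \<open>0\<close> and
    \<open>\<rho>\<close>, each enlarged by \<open>\<epsilon>\<close>, still add up to less than 1.
    The first limit is 0 because the spectral parameter is \<open>\<alpha>\<close>.\<close>
  define \<epsilon> where "\<epsilon> = (1 - \<rho>) / 3"
  have \<epsilon>: "\<epsilon> > 0" using \<rho> by (simp add: \<epsilon>_def)
  have "\<forall>\<^sub>F n in sequentially. cmod (\<alpha> - a (Suc n)) / cmod (b (Suc n)) < \<epsilon>
      \<and> cmod (c n) / cmod (b (Suc n)) < \<rho> + \<epsilon>"
    using order_tendstoD(2)[OF a \<epsilon>] order_tendstoD(2)[OF c, of "\<rho> + \<epsilon>"] \<epsilon>
    by (intro eventually_conj) auto
  then obtain M where M: "\<And>n. n \<ge> M \<Longrightarrow> cmod (\<alpha> - a (Suc n)) / cmod (b (Suc n)) < \<epsilon>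
      \<and> cmod (c n) / cmod (b (Suc n)) < \<rho> + \<epsilon>"
    by (auto simp: eventually_sequentially)
  define g where "g = jacobi_solution a b c \<alpha>"
  have g: "three_term_solution a b c \<alpha> g" unfolding g_def by (rule jacobi_solution_three_term[OF b0])
  have "summable (\<lambda>n. cmod (g n))"
  proof (rule summable_of_three_term_bound[where N = M and p = \<epsilon> and q = "\<rho> + \<epsilon>"])
    fix n assume "n \<ge> M"
    note M = M[OF this]
    have "b (Suc n) * g (Suc (Suc n)) = (\<alpha> - a (Suc n)) * g (Suc n) - c n * g n"
      using g by (simp add: three_term_solution_def)
    then have "g (Suc (Suc n)) = ((\<alpha> - a (Suc n)) * g (Suc n) - c n * g n) / b (Suc n)"
      using b0[of "Suc n"] by (metis nonzero_mult_div_cancel_left)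
    then have "g (Suc (Suc n)) = (\<alpha> - a (Suc n)) / b (Suc n) * g (Suc n) - c n / b (Suc n) * g n"
      by (simp only: diff_divide_distrib[of "_ * _"] times_divide_eq_left)
    then have "cmod (g (Suc (Suc n))) \<le> cmod (\<alpha> - a (Suc n)) / cmod (b (Suc n)) * cmod (g (Suc n))
        + cmod (c n) / cmod (b (Suc n)) * cmod (g n)"
      using norm_triangle_ineq4 by (metis norm_divide norm_mult)
    also have "\<dots> \<le> \<epsilon> * cmod (g (Suc n)) + (\<rho> + \<epsilon>) * cmod (g n)"
      using M by (intro add_mono mult_right_mono) auto
    finally show "cmod (g (Suc (Suc n))) \<le> \<epsilon> * cmod (g (Suc n)) + (\<rho> + \<epsilon>) * cmod (g n)" .
  next
    show "\<epsilon> + (\<rho> + \<epsilon>) < 1" using \<rho> by (simp add: \<epsilon>_def field_simps)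
  qed (use \<epsilon> \<rho> in auto)
  from eigenvector_of_solution[OF g _ this] show ?thesis
    by (auto simp: g_def jacobi_solution_0)
qed

section \<open>The normal case: reduction to a self-adjoint contraction\<close>

lemma hyperinvariant_of_normal:
  assumes b0: "\<And>n. b n \<noteq> 0" and t0: "\<And>n. t n = 0"
  shows "\<exists>M. hyperinvariant T M \<and> M \<noteq> {0} \<and> M \<noteq> UNIV"
proof -
  have d0: "d n = 0" for n by (cases n) (simp_all add: d_0 d_Suc t0)
  \<comment> \<open>A positive form with zero diagonal entries has zero off-diagonal
    entries.\<close>
  have Q0: "Q (e m) (e n) = 0" for m n
    using cmod_Q_le[of "e m" "e n"] d0 by (simp add: d_def)
  define r where "r = cnj (c 0) / b 0"
  \<comment> \<open>The vanishing entries two steps off the diagonal propagate one ratio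
    \<open>r\<close> along the whole matrix.\<close>
  have c: "cnj (c n) = r * b n" for n
  proof (induction n)
    case 0
    then show ?case using b0[of 0] by (simp add: r_def)
  next
    case (Suc n)
    have "b n * cnj (c (Suc n)) = b n * (r * b (Suc n))"
      using Q0[of n "Suc (Suc n)"] Suc by (simp add: Q_e_off_2 mult_ac)
    then show ?case using b0[of n] by simp
  qed
  have "cmod (c 0) = cmod (b 0)"
    using t0[of 0] by (simp add: t_def power2_eq_iff_nonneg)
  then have r1: "cmod r = 1" using b0[of 0] by (simp add: r_def norm_divide)
  then have rr: "r * cnj r = 1" by (metis complex_norm_square of_real_1 power_one)
  have bc: "cnj (b n) = r * c n" for n
  proof -
    have "c n = cnj r * cnj (b n)" using arg_cong[OF c[of n], of cnj] by simp
    then have "r * c n = (r * cnj r) * cnj (b n)" by (simp only: mult_ac)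
    then show ?thesis by (simp add: rr)
  qed
  \<comment> \<open>The vanishing entries next to the diagonal make
    \<open>cnj (a n) - r * a n\<close> independent of \<open>n\<close>.\<close>
  have a: "cnj (a n) = r * a n + (cnj (a 0) - r * a 0)" for n
  proof (induction n)
    case (Suc n)
    have "r * b n * (a n - a (Suc n)) + b n * cnj (a (Suc n) - a n) = 0"
      using Q0[of n "Suc n"] by (simp add: Q_e_off_1 c)
    then have "b n * (cnj (a (Suc n)) - (r * a (Suc n) + (cnj (a n) - r * a n))) = 0"
      by (simp add: algebra_simps)
    then have "cnj (a (Suc n)) = r * a (Suc n) + (cnj (a n) - r * a n)" using b0[of n] by simp
    then show ?case using Suc by simp
  qed simp
  define \<gamma> where "\<gamma> = cnj (a 0) - r * a 0"
  \<comment> \<open>This is \<open>T' = r T + \<gamma>\<close>, written in the shape of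
    \<open>bounded_operator_shift\<close> by means of \<open>r * cnj r = 1\<close>.\<close>
  have T'_eq: "T' x = r *\<^sub>C (T x - (- cnj r * \<gamma>) *\<^sub>C x)" for x
  proof (rule orthonormal_basis_operator_eq[OF basis T' bounded_operator_shift[OF T]])
    have *: "r *\<^sub>C (y - (- cnj r * \<gamma>) *\<^sub>C x) = r *\<^sub>C y + \<gamma> *\<^sub>C x" for x y
      by (simp add: scaleC_add_right scaleC_scaleC mult.assoc[symmetric] rr)
    show "T' (e n) = r *\<^sub>C (T (e n) - (- cnj r * \<gamma>) *\<^sub>C e n)" for n
      unfolding *
      by (rule orthonormal_basis_eqI[OF basis])
        (auto simp: cinner_simps e_cinner T'_entry T_entry c bc a[folded \<gamma>_def])
  qed
  obtain K where K: "K > 0" "\<And>x. norm (T x) \<le> K * norm x" using bounded_coefficients by metis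
  \<comment> \<open>Scales \<open>T - a 0\<close>, whose norm is at most
    \<open>K + cmod (a 0)\<close>, to a contraction.\<close>
  define \<kappa> where "\<kappa> = 1 / (K + cmod (a 0))"
  have \<kappa>: "\<kappa> > 0" using K by (simp add: \<kappa>_def add_pos_nonneg)
  \<comment> \<open>The adjoint of \<open>T - a 0\<close> is \<open>r\<close> times itself, so
    rotating by a square root of \<open>r\<close> makes it self-adjoint.\<close>
  define s where "s = csqrt r"
  have s: "s * s = r" "cmod s = 1"
    by (simp_all add: s_def r1 norm_csqrt flip: power2_eq_square)
  then have ss: "s * cnj s = 1" by (metis complex_norm_square of_real_1 power_one)
  have sr: "s * cnj r = cnj s"
  proof -
    have "s * cnj r = (s * cnj s) * cnj s" by (simp flip: s(1))
    then show ?thesis by (simp add: ss)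
  qed
  define A where "A x = (complex_of_real \<kappa> * s) *\<^sub>C (T x - a 0 *\<^sub>C x)" for x
  have "\<exists>M. hyperinvariant A M \<and> M \<noteq> {0} \<and> M \<noteq> UNIV"
  proof (rule hyperinvariant_of_selfadjoint[where u = "e 0"])
    show "bounded_operator A" unfolding A_def by (rule bounded_operator_shift[OF T])
    show "cinner (A x) y = cinner x (A y)" for x y
    proof -
      have "cinner (T x) y = cnj r * cinner x (T y) + cnj \<gamma> * cinner x y"
        unfolding adjoint T'_eq using rr
        by (simp add: cinner_simps algebra_simps)
      then have "cinner (T x) y - a 0 * cinner x y = cnj r * (cinner x (T y) - cnj (a 0) * cinner x y)"
        by (simp add: \<gamma>_def algebra_simps)
      then have "cinner (A x) y = \<kappa> * (s * cnj r) * (cinner x (T y) - cnj (a 0) * cinner x y)"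
        by (simp add: A_def cinner_simps)
      then show ?thesis by (simp add: sr) (simp add: A_def cinner_simps)
    qed
    show "norm (A x) \<le> norm x" for x
    proof -
      have "norm (A x) = \<kappa> * norm (T x - a 0 *\<^sub>C x)"
        using \<kappa> by (simp add: A_def norm_scaleC norm_mult s)
      also have "norm (T x - a 0 *\<^sub>C x) \<le> K * norm x + cmod (a 0) * norm x"
        using norm_triangle_ineq4[of "T x" "a 0 *\<^sub>C x"] K(2)[of x] by (simp add: norm_scaleC)
      then have "\<kappa> * norm (T x - a 0 *\<^sub>C x) \<le> \<kappa> * (K * norm x + cmod (a 0) * norm x)"
        using \<kappa> by (intro mult_left_mono) auto
      also have "\<dots> = norm x"
        using \<kappa> by (simp add: \<kappa>_def field_simps flip: distrib_right)
      finally show ?thesis .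
    qed
    have Ae: "A (e 0) = (\<kappa> * s * b 0) *\<^sub>C e 1"
      by (simp add: A_def T_e_0 scaleC_scaleC)
    then show "cinner (A (e 0)) (e 0) = 0" by (simp add: cinner_simps e_cinner)
    have "norm (A (e 0)) \<noteq> 0" using \<kappa> s(2) b0[of 0] by (simp add: Ae norm_scaleC norm_mult norm_e)
    then show "A (e 0) \<noteq> 0" by auto
  qed
  moreover have "S \<circ> A = A \<circ> S" if S: "bounded_operator S" "S \<circ> T = T \<circ> S" for S
  proof
    fix x
    have "S (T x) = T (S x)" using S(2) by (metis comp_apply)
    then show "(S \<circ> A) x = (A \<circ> S) x" by (simp add: A_def bounded_operator_simps[OF S(1)])
  qed
  ultimately show ?thesis using hyperinvariant_of_commutant_subset by metis
qed

lemma hyperinvariant_exists: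
  assumes "\<not> (\<exists>c. T = (\<lambda>x. c *\<^sub>C x))"
  shows "\<exists>M. hyperinvariant T M \<and> M \<noteq> {0} \<and> M \<noteq> UNIV"
proof (cases "(\<forall>n. b n \<noteq> 0) \<and> (\<forall>n. t n = 0)")
  case True
  then show ?thesis by (intro hyperinvariant_of_normal) auto
next
  case False
  then consider m where "b m = 0" | N where "\<And>n. b n \<noteq> 0" "t N > 0"
    using t_nonneg by (metis order_le_less)
  then obtain x \<mu> where "x \<noteq> 0" "\<And>y. cinner (T y) x = \<mu> * cinner y x"
    by cases (use eigenvector_of_zero eigenvector_of_nonnormal in blast)+
  then show ?thesis by (rule hyperinvariant_of_adjoint_eigenvector[OF T assms])
qed

end

theorem corollary2p4:
  fixes T :: "'a::complex_hilbert \<Rightarrow> 'a"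
  assumes "infinite_dimensional TYPE('a)"
    and "separable_space (euclidean :: 'a topology)"
    and "bounded_operator T"
    and "hyponormal T"
    and "tridiagonal T"
    and "\<not> (\<exists>c. T = (\<lambda>x. c *\<^sub>C x))"
  shows "\<exists>M. hyperinvariant T M \<and> M \<noteq> {0} \<and> M \<noteq> UNIV"
proof -
  obtain e where e: "orthonormal_basis e"
    "\<And>m n. \<bar>int m - int n\<bar> \<ge> 2 \<Longrightarrow> cinner (T (e n)) (e m) = 0"
    using assms(5) unfolding tridiagonal_def by blast
  note adj = cinner_hilbert_adjoint[OF e(1) assms(3)]
  \<comment> \<open>Positivity of the self-commutator at \<open>x\<close>, rewritten with squared
    norms.\<close>
  have "norm (hilbert_adjoint T x) \<le> norm (T x)" for x
  proof (rule power2_le_imp_le)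
    have "cinner (hilbert_adjoint T (T x)) x = cnj (cinner (T x) (T x))"
      by (metis adj cinner_commute)
    moreover have "cinner (T (hilbert_adjoint T x)) x = cinner (hilbert_adjoint T x) (hilbert_adjoint T x)"
      by (rule adj)
    moreover have "0 \<le> Re (cinner (hilbert_adjoint T (T x) - T (hilbert_adjoint T x)) x)"
      using assms(4) unfolding hyponormal_def positive_semidefinite_def
      by (auto simp: complex_nonneg_Reals_iff)
    ultimately show "(norm (hilbert_adjoint T x))\<^sup>2 \<le> (norm (T x))\<^sup>2"
      by (simp add: cinner_simps cinner_self)
  qed simp
  then interpret tridiagonal_hyponormal T "hilbert_adjoint T" e
    using e assms(3) adj bounded_operator_hilbert_adjoint[OF e(1) assms(3)]
    by unfold_locales auto
  show ?thesis using assms(6) by (rule hyperinvariant_exists)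
qed

end
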